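(* Let $f=h+\overline{g}\in\mathcal{H_R}$ be a sense-preserving harmonic mapping with $h(z)=z+\sum_{n=2}^\infty a_nz^n$ and $g(z)=\sum_{n=1}^\infty b_nz^n$. Then $|a_n|\le \frac{1}{n}$ for all $n\ge 2$. The estimate is sharp, i.e. for each $n\ge 2$ the bound $1/n$ cannot be replaced by a smaller one valid for all $f\in\mathcal{H_R}$.
   Context: Let $\mathbb{D}=\{z\in\mathbb{C}:|z|<1\}$. $\mathcal{A}$ is the class of analytic functions $h$ in $\mathbb{D}$ with $h(0)=0$, $h'(0)=1$. $\mathcal{H}$ is the class of all sense-preserving harmonic functions $f=h+\overline{g}$ in $\mathbb{D}$, with $h,g$ analytic in $\mathbb{D}$ of the form $h(z)=z+\sum_{n=2}^\infty a_nz^n$, $g(z)=\sum_{n=1}^\infty b_nz^n$; sense-preserving means that the Jacobian $J_f=|h'|^2-|g'|^2$ is positive in $\mathbb{D}$. $\mathcal{R}$ is the class of functions $h\in\mathcal{A}$ such that, for some $m\in\mathbb{N}=\{1,2,3,\dots\}$, $h'(z)=\frac{m}{m-z^m}$ for all $z\in\mathbb{D}$. $\mathcal{H_R}$ is the class of all $f=h+\overline{g}\in\mathcal{H}$ with $h\in\mathcal{R}$. *)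

theory Defs
  imports "HOL-Complex_Analysis.Complex_Analysis"
begin

abbreviation unit_disc :: "complex set" ("\<D>")
  where "\<D> \<equiv> ball 0 1"

definition class_A :: "(complex \<Rightarrow> complex) set" where
  "class_A = {h. h analytic_on \<D> \<and> h 0 = 0 \<and> deriv h 0 = 1}"

definition class_R :: "(complex \<Rightarrow> complex) set" where
  "class_R = {h \<in> class_A. \<exists>m::nat. m \<ge> 1 \<and>
      (\<forall>z\<in>\<D>. deriv h z = of_nat m / (of_nat m - z ^ m))}"

text \<open>
  \<^term>\<open>harmonic_rep f h g a b\<close> says that \<open>f = h + cnj g\<close> on the disc, where
  \<open>h(z) = z + a\<^sub>2 z^2 + a\<^sub>3 z^3 + \<dots>\<close> and \<open>g(z) = b\<^sub>1 z + b\<^sub>2 z^2 + \<dots>\<close> are analytic there; the entries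
  \<open>a 0\<close>, \<open>a 1\<close> and \<open>b 0\<close> of the coefficient sequences are irrelevant, as are the
  values of the functions outside the disc.
\<close>
definition harmonic_rep ::
  "(complex \<Rightarrow> complex) \<Rightarrow> (complex \<Rightarrow> complex) \<Rightarrow> (complex \<Rightarrow> complex) \<Rightarrow>
   (nat \<Rightarrow> complex) \<Rightarrow> (nat \<Rightarrow> complex) \<Rightarrow> bool" where
  "harmonic_rep f h g a b \<longleftrightarrow>
     h analytic_on \<D> \<and> g analytic_on \<D> \<and>
     (\<forall>z\<in>\<D>. f z = h z + cnj (g z)) \<and>
     (\<forall>z\<in>\<D>. (\<lambda>n. a (n + 2) * z ^ (n + 2)) sums (h z - z)) \<and>
     (\<forall>z\<in>\<D>. (\<lambda>n. b (n + 1) * z ^ (n + 1)) sums g z)"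

text \<open>
  The Jacobian of \<open>h + cnj g\<close> as a map of the real plane: the squared modulus of its \<open>z\<close>-derivative
  \<open>deriv h\<close> minus that of its \<open>cnj z\<close>-derivative \<open>cnj (deriv g)\<close>.
\<close>
definition harmonic_jacobian ::
  "(complex \<Rightarrow> complex) \<Rightarrow> (complex \<Rightarrow> complex) \<Rightarrow> complex \<Rightarrow> real" where
  "harmonic_jacobian h g z = (cmod (deriv h z))\<^sup>2 - (cmod (deriv g z))\<^sup>2"

definition sense_preserving_rep ::
  "(complex \<Rightarrow> complex) \<Rightarrow> (complex \<Rightarrow> complex) \<Rightarrow> (complex \<Rightarrow> complex) \<Rightarrow>
   (nat \<Rightarrow> complex) \<Rightarrow> (nat \<Rightarrow> complex) \<Rightarrow> bool" where
  "sense_preserving_rep f h g a b \<longleftrightarrow>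
     harmonic_rep f h g a b \<and> (\<forall>z\<in>\<D>. harmonic_jacobian h g z > 0)"

definition class_H :: "(complex \<Rightarrow> complex) set" where
  "class_H = {f. \<exists>h g a b. sense_preserving_rep f h g a b}"

definition class_HR :: "(complex \<Rightarrow> complex) set" where
  "class_HR = {f \<in> class_H. \<exists>h g a b. sense_preserving_rep f h g a b \<and> h \<in> class_R}"

end

theory Submission
  imports Defs
begin

text \<open>
  If \<open>h + cnj g\<close> and \<open>h\<^sub>1 + cnj g\<^sub>1\<close> agree, then \<open>h - h\<^sub>1\<close> is both holomorphic and antiholomorphic,
  hence constant, so the analytic part of a mapping in \<open>class_HR\<close> is determined by the mapping and
  lies in \<open>class_R\<close>. Comparing coefficients in \<open>(m - z ^ m) h'(z) = m\<close> yields the recursion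
  \<open>m c\<^sub>n = c\<^sub>n\<^sub>-\<^sub>m\<close> for the coefficients of \<open>h'\<close>, which therefore have modulus at most \<open>1\<close>. Equality
  holds for all coefficients when \<open>m = 1\<close>, that is, for \<open>h(z) = - Ln (1 - z)\<close>.
\<close>

text \<open>A nonconstant image would be open by the open mapping theorem, but a vertical shift of
  any image point leaves the real line.\<close>

lemma holomorphic_Reals_imp_constant_on:
  assumes "f holomorphic_on S" "open S" "connected S" "f ` S \<subseteq> \<real>"
  shows "f constant_on S"
proof (rule ccontr)
  assume nc: "\<not> f constant_on S"
  then obtain x where x: "x \<in> S" by (auto simp: constant_on_def)
  have "open (f ` S)"
    using open_mapping_thm[OF assms(1-3) assms(2)] nc by blast
  then obtain e where e: "e > 0" "ball (f x) e \<subseteq> f ` S"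
    using x by (meson image_eqI open_contains_ball)
  have "f x + \<i> * of_real (e / 2) \<in> ball (f x) e"
    using e(1) by (simp add: dist_norm norm_mult)
  then have "Im (f x + \<i> * of_real (e / 2)) = 0"
    using e(2) assms(4) complex_is_Real_iff by blast
  moreover have "Im (f x) = 0"
    using x assms(4) complex_is_Real_iff by blast
  ultimately show False using e(1) by simp
qed

text \<open>Since \<open>g\<close> is the conjugate of \<open>f\<close> on \<open>S\<close>, the
  combinations \<open>f + g\<close> and \<open>\<i> * (f - g)\<close> equal \<open>2 * Re f\<close>
  and \<open>- 2 * Im f\<close>, so both are real-valued and holomorphic.\<close>

lemma holomorphic_eq_cnj_holomorphic_imp_constant_on:
  assumes f: "f holomorphic_on S" and g: "g holomorphic_on S"
    and S: "open S" "connected S" and eq: "\<And>z. z \<in> S \<Longrightarrow> f z = cnj (g z)"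
  shows "f constant_on S"
proof -
  have "(\<lambda>z. f z + g z) constant_on S"
    by (rule holomorphic_Reals_imp_constant_on)
       (use S in \<open>auto intro!: holomorphic_intros f g simp: eq complex_is_Real_iff\<close>)
  moreover have "(\<lambda>z. \<i> * (f z - g z)) constant_on S"
    by (rule holomorphic_Reals_imp_constant_on)
       (use S in \<open>auto intro!: holomorphic_intros f g simp: eq complex_is_Real_iff\<close>)
  ultimately obtain c d where cd: "\<And>z. z \<in> S \<Longrightarrow> f z + g z = c" "\<And>z. z \<in> S \<Longrightarrow> \<i> * (f z - g z) = d"
    unfolding constant_on_def by blast
  have "f z = (c - \<i> * d) / 2" if "z \<in> S" for z
  proof -
    have "f z = ((f z + g z) - \<i> * (\<i> * (f z - g z))) / 2"
      by (simp add: field_simps)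
    then show ?thesis using cd that by simp
  qed
  then show ?thesis unfolding constant_on_def by blast
qed

text \<open>Neither series has a constant term. This fixes the additive constant that the
  decomposition of \<open>f\<close> would otherwise leave free.\<close>

lemma harmonic_rep_at_0:
  assumes "harmonic_rep f h g a b"
  shows "h 0 = 0" "g 0 = 0"
proof -
  have "(\<lambda>n. a (n + 2) * 0 ^ (n + 2)) sums (h 0 - 0)" "(\<lambda>n. b (n + 1) * 0 ^ (n + 1)) sums g 0"
    using assms unfolding harmonic_rep_def by (meson centre_in_ball zero_less_one)+
  then show "h 0 = 0" "g 0 = 0" by (simp_all add: sums_iff)
qed

text \<open>Membership in \<open>class_HR\<close> only provides some representation with analytic
  part in \<open>class_R\<close>; this carries the information over to an arbitrary
  representation.\<close>

lemma harmonic_rep_analytic_part_unique: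
  assumes r: "harmonic_rep f h g a b" and r1: "harmonic_rep f h1 g1 a1 b1" and z: "z \<in> \<D>"
  shows "h z = h1 z"
proof -
  have hol: "h holomorphic_on \<D>" "h1 holomorphic_on \<D>" "g holomorphic_on \<D>" "g1 holomorphic_on \<D>"
    using r r1 by (auto simp: harmonic_rep_def analytic_imp_holomorphic)
  have "h w - h1 w = cnj (g1 w - g w)" if "w \<in> \<D>" for w
  proof -
    have "f w = h w + cnj (g w)" "f w = h1 w + cnj (g1 w)"
      using r r1 that by (auto simp: harmonic_rep_def)
    then show ?thesis by (simp add: algebra_simps)
  qed
  then have "(\<lambda>w. h w - h1 w) constant_on \<D>"
    by (intro holomorphic_eq_cnj_holomorphic_imp_constant_on[where g = "\<lambda>w. g1 w - g w"])
       (auto intro!: holomorphic_intros hol)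
  then have "h z - h1 z = h 0 - h1 0"
    using z unfolding constant_on_def by (metis centre_in_ball zero_less_one)
  then show ?thesis
    using harmonic_rep_at_0[OF r] harmonic_rep_at_0[OF r1] by simp
qed

lemma harmonic_rep_has_fps_expansion:
  assumes "harmonic_rep f h g a b"
  shows "h has_fps_expansion Abs_fps (\<lambda>n. if n = 0 then 0 else if n = 1 then 1 else a n)"
    (is "_ has_fps_expansion Abs_fps ?c")
proof (rule has_fps_expansionI)
  have "(\<lambda>n. ?c n * z ^ n) sums h z" if "z \<in> \<D>" for z
  proof -
    have "(\<lambda>n. a (n + 2) * z ^ (n + 2)) sums (h z - z)"
      using assms that by (auto simp: harmonic_rep_def simp del: power_Suc)
    then have "(\<lambda>n. ?c (n + 2) * z ^ (n + 2)) sums (h z - z)"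
      by simp
    then show ?thesis
      \<comment> \<open>The two restored initial terms are \<open>0\<close> and \<open>z\<close>,
        whatever the values \<open>a 0\<close> and \<open>a 1\<close>.\<close>
      by (subst (asm) sums_iff_shift) (simp add: numeral_2_eq_2)
  qed
  moreover have "eventually (\<lambda>z. z \<in> \<D>) (nhds (0 :: complex))"
    by (intro eventually_nhds_in_open) auto
  ultimately show "eventually (\<lambda>z. (\<lambda>n. fps_nth (Abs_fps ?c) n * z ^ n) sums h z) (nhds 0)"
    by (auto elim: eventually_mono)
qed

text \<open>Strong induction on the recursion between coefficients at distance \<open>m\<close>. As
  \<open>m \<ge> 1\<close>, the source term \<open>m\<close> at index 0 and the term of index
  \<open>n - m\<close> never occur together, so the right-hand side has modulus at most
  \<open>m\<close>.\<close>

lemma fps_recurrence_norm_le_1: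
  fixes F :: "complex fps"
  assumes "(fps_const (of_nat m) - fps_X ^ m) * F = fps_const (of_nat m)" "m \<ge> 1"
  shows "cmod (fps_nth F n) \<le> 1"
proof (induction n rule: less_induct)
  case (less n)
  have "fps_nth (fps_const (of_nat m) * F - fps_X ^ m * F) n = fps_nth (fps_const (of_nat m)) n"
    using assms(1) by (simp add: algebra_simps)
  then have rec: "of_nat m * fps_nth F n =
      (if n < m then 0 else fps_nth F (n - m)) + (if n = 0 then of_nat m else 0)"
    by (auto simp: fps_X_power_mult_nth diff_eq_eq add.commute)
  have "cmod (of_nat m * fps_nth F n) \<le> real m"
  proof (cases "n < m")
    case True
    then show ?thesis by (subst rec) auto
  next
    case False
    then have "cmod (fps_nth F (n - m)) \<le> 1"
      using less assms(2) by simp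
    then show ?thesis using False assms(2) by (subst rec) auto
  qed
  then show ?case using assms(2) by (simp add: norm_mult)
qed

lemma class_R_fps_nth_le:
  assumes h: "h \<in> class_R" and F: "h has_fps_expansion F" and n: "n \<ge> 1"
  shows "cmod (fps_nth F n) \<le> 1 / real n"
proof -
  obtain m where m: "m \<ge> 1" "\<And>z. z \<in> \<D> \<Longrightarrow> deriv h z = of_nat m / (of_nat m - z ^ m)"
    using h by (auto simp: class_R_def)
  have "(of_nat m - z ^ m) * deriv h z = of_nat m" if z: "z \<in> \<D>" for z
  proof -
    have "cmod (z ^ m) < 1"
      using z m(1) by (simp add: norm_power power_less_one_iff)
    \<comment> \<open>The modulus of \<open>z ^ m\<close> is below 1, that of \<open>m\<close> is at
      least 1.\<close>
    then have "of_nat m - z ^ m \<noteq> 0"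
      using m(1) by (metis eq_iff_diff_eq_0 norm_of_nat not_less of_nat_1 of_nat_le_iff)
    then show ?thesis using m(2)[OF z] by simp
  qed
  moreover have "eventually (\<lambda>z. z \<in> \<D>) (nhds (0 :: complex))"
    by (intro eventually_nhds_in_open) auto
  ultimately have ev: "eventually (\<lambda>z. (of_nat m - z ^ m) * deriv h z = of_nat m) (nhds 0)"
    by (auto elim: eventually_mono)
  have "(\<lambda>z. (of_nat m - z ^ m) * deriv h z) has_fps_expansion
      (fps_const (of_nat m) - fps_X ^ m) * fps_deriv F"
    by (intro fps_expansion_intros F)
  then have "(\<lambda>z. of_nat m) has_fps_expansion (fps_const (of_nat m) - fps_X ^ m) * fps_deriv F"
    using has_fps_expansion_cong[OF ev refl] by simp
  then have "(fps_const (of_nat m) - fps_X ^ m) * fps_deriv F = fps_const (of_nat m)"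
    by (rule fps_expansion_unique_complex) (rule has_fps_expansion_const)
  \<comment> \<open>The coefficient of index \<open>n - 1\<close> in \<open>fps_deriv F\<close> is
    \<open>n\<close> times that of index \<open>n\<close> in \<open>F\<close>.\<close>
  from fps_recurrence_norm_le_1[OF this m(1), of "n - 1"]
  have "real n * cmod (fps_nth F n) \<le> 1"
    using n by (simp add: norm_mult del: of_nat_Suc)
  then show ?thesis using n by (simp add: field_simps)
qed

text \<open>The real part of \<open>1 - z\<close> is positive, so \<open>Ln (1 - z)\<close> avoids
  the branch cut.\<close>

lemma one_minus_notin_nonpos_Reals:
  assumes "cmod z < 1"
  shows "1 - z \<notin> \<real>\<^sub>\<le>\<^sub>0"
  using assms complex_Re_le_cmod[of z] by (auto simp: complex_nonpos_Reals_iff)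

lemma has_field_derivative_minus_Ln_one_minus:
  assumes "cmod z < 1"
  shows "((\<lambda>z. - Ln (1 - z)) has_field_derivative 1 / (1 - z)) (at z)"
  using one_minus_notin_nonpos_Reals[OF assms]
  by (auto intro!: derivative_eq_intros simp: field_simps)

lemma minus_Ln_one_minus_in_class_R: "(\<lambda>z. - Ln (1 - z)) \<in> class_R"
proof -
  have "deriv (\<lambda>z. - Ln (1 - z)) z = 1 / (1 - z)" if "cmod z < 1" for z
    by (rule DERIV_imp_deriv[OF has_field_derivative_minus_Ln_one_minus[OF that]])
  moreover have "(\<lambda>z. - Ln (1 - z)) analytic_on \<D>"
    using one_minus_notin_nonpos_Reals by (auto intro!: analytic_intros)
  ultimately show ?thesis
    by (auto simp: class_R_def class_A_def intro!: exI[of _ 1])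
qed

text \<open>With zero co-analytic part the Jacobian is the squared modulus of
  \<open>1 / (1 - z)\<close>, hence positive. This one mapping attains the bound for every
  \<open>n\<close> at once.\<close>

lemma sense_preserving_rep_minus_Ln_one_minus:
  "sense_preserving_rep (\<lambda>z. - Ln (1 - z)) (\<lambda>z. - Ln (1 - z)) (\<lambda>_. 0) (\<lambda>n. 1 / of_nat n) (\<lambda>_. 0)"
proof -
  have "(\<lambda>n. 1 / of_nat (n + 2) * z ^ (n + 2)) sums (- Ln (1 - z) - z)" if "cmod z < 1" for z
  proof -
    have "(\<lambda>n. z ^ n / of_nat n) sums - Ln (1 - z)"
      using sums_minus[OF Ln_series'[of "- z"]] that by simp
    \<comment> \<open>The term at \<open>n = 0\<close> is 0 because division by zero yields 0, so
      the shift by two removes just \<open>z\<close>.\<close>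
    then have "(\<lambda>n. z ^ (n + 2) / of_nat (n + 2)) sums (- Ln (1 - z) - z)"
      by (subst sums_iff_shift) (simp add: numeral_2_eq_2)
    then show ?thesis by simp
  qed
  moreover have "deriv (\<lambda>z. - Ln (1 - z)) z \<noteq> 0" if "cmod z < 1" for z
    using DERIV_imp_deriv[OF has_field_derivative_minus_Ln_one_minus[OF that]] that by auto
  ultimately show ?thesis
    using minus_Ln_one_minus_in_class_R
    by (auto simp: sense_preserving_rep_def harmonic_rep_def harmonic_jacobian_def
        class_R_def class_A_def)
qed

theorem theorem2p6:
  "(\<forall>f\<in>class_HR. \<forall>h g a b. sense_preserving_rep f h g a b \<longrightarrow>
       (\<forall>n\<ge>2. cmod (a n) \<le> 1 / real n)) \<and>
   (\<forall>n\<ge>2. \<forall>c::real. c < 1 / real n \<longrightarrow>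
       \<not> (\<forall>f\<in>class_HR. \<forall>h g a b. sense_preserving_rep f h g a b \<longrightarrow> cmod (a n) \<le> c))"
proof (intro conjI ballI allI impI)
  fix f h g a b and n :: nat
  assume "f \<in> class_HR" and rep: "sense_preserving_rep f h g a b" and n: "n \<ge> 2"
  then obtain h1 g1 a1 b1 where 1: "harmonic_rep f h1 g1 a1 b1" "h1 \<in> class_R"
    by (auto simp: class_HR_def sense_preserving_rep_def)
  have r: "harmonic_rep f h g a b"
    using rep by (simp add: sense_preserving_rep_def)
  have "eventually (\<lambda>z. z \<in> \<D>) (nhds (0 :: complex))"
    by (intro eventually_nhds_in_open) auto
  then have "eventually (\<lambda>z. h z = h1 z) (nhds 0)"
    by eventually_elim (rule harmonic_rep_analytic_part_unique[OF r 1(1)])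
  \<comment> \<open>The series with coefficients \<open>a\<close> now expands \<open>h1\<close>,
    which is known to lie in \<open>class_R\<close>.\<close>
  from iffD1[OF has_fps_expansion_cong[OF this refl] harmonic_rep_has_fps_expansion[OF r]]
  show "cmod (a n) \<le> 1 / real n"
    using class_R_fps_nth_le[OF 1(2), of _ n] n by fastforce
next
  fix n :: nat and c :: real
  assume c: "c < 1 / real n"
  have "(\<lambda>z. - Ln (1 - z)) \<in> class_HR"
    using sense_preserving_rep_minus_Ln_one_minus minus_Ln_one_minus_in_class_R
    unfolding class_HR_def class_H_def by blast
  moreover have "\<not> cmod (1 / of_nat n) \<le> c"
    using c by (simp add: norm_divide)
  ultimately show "\<not> (\<forall>f\<in>class_HR. \<forall>h g a b. sense_preserving_rep f h g a b \<longrightarrow> cmod (a n) \<le> c)"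
    using sense_preserving_rep_minus_Ln_one_minus by blast
qed

end
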